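(* There is no computable set $C\subseteq\mathbb{N}$ with $\mathbf{M}\subseteq C$ and $C\cap E_0=\varnothing$.
   Context: $(\varphi_e)_{e\in\mathbb{N}}$ is a fixed standard acceptable numbering of the unary partial computable functions. $\mathbf{M}=\{p\in\mathbb{N}:\varphi_p(0)\!\downarrow=1\}$ and $E_0=\{p\in\mathbb{N}:\varphi_p(0)\!\downarrow=0\}$. *)

theory Defs
  imports Main
begin

text \<open>
  Partial functions of arity \<open>n\<close> are represented as partial functions on lists, of which only
  the values on lists of length \<open>n\<close> are meaningful; \<open>None\<close> means divergence.
\<close>

definition pcomp :: "(nat list \<rightharpoonup> nat) \<Rightarrow> (nat list \<rightharpoonup> nat) list \<Rightarrow> (nat list \<rightharpoonup> nat)" where
  "pcomp f gs xs =
     (if \<forall>g\<in>set gs. g xs \<noteq> None then f (map (\<lambda>g. the (g xs)) gs) else None)"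

text \<open>The recursion argument comes first.\<close>

fun primrecursion :: "(nat list \<rightharpoonup> nat) \<Rightarrow> (nat list \<rightharpoonup> nat) \<Rightarrow> (nat list \<rightharpoonup> nat)" where
  "primrecursion f g [] = None"
| "primrecursion f g (0 # xs) = f xs"
| "primrecursion f g (Suc k # xs) =
     Option.bind (primrecursion f g (k # xs)) (\<lambda>r. g (k # r # xs))"

text \<open>Unbounded search diverges if it meets an undefined value before the first zero.\<close>

definition minimization :: "(nat list \<rightharpoonup> nat) \<Rightarrow> (nat list \<rightharpoonup> nat)" where
  "minimization f xs =
     (if \<exists>k. f (k # xs) = Some 0 \<and> (\<forall>j<k. f (j # xs) \<noteq> None)
      then Some (LEAST k. f (k # xs) = Some 0)
      else None)"

inductive partial_recursive :: "nat \<Rightarrow> (nat list \<rightharpoonup> nat) \<Rightarrow> bool" where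
  zero: "partial_recursive n (\<lambda>xs. Some 0)"
| succ: "partial_recursive 1 (\<lambda>xs. Some (Suc (xs ! 0)))"
| proj: "i < n \<Longrightarrow> partial_recursive n (\<lambda>xs. Some (xs ! i))"
| comp: "partial_recursive (length gs) f \<Longrightarrow> \<forall>g\<in>set gs. partial_recursive n g \<Longrightarrow>
    partial_recursive n (pcomp f gs)"
| prec: "partial_recursive n f \<Longrightarrow> partial_recursive (n + 2) g \<Longrightarrow>
    partial_recursive (n + 1) (primrecursion f g)"
| mini: "partial_recursive (n + 1) f \<Longrightarrow> partial_recursive n (minimization f)"

definition partial_computable :: "(nat \<rightharpoonup> nat) \<Rightarrow> bool" where
  "partial_computable f \<longleftrightarrow> (\<exists>g. partial_recursive 1 g \<and> (\<forall>x. f x = g [x]))"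

definition partial_computable2 :: "(nat \<Rightarrow> nat \<rightharpoonup> nat) \<Rightarrow> bool" where
  "partial_computable2 f \<longleftrightarrow> (\<exists>g. partial_recursive 2 g \<and> (\<forall>x y. f x y = g [x, y]))"

definition computable :: "(nat \<Rightarrow> nat) \<Rightarrow> bool" where
  "computable f \<longleftrightarrow> partial_computable (\<lambda>x. Some (f x))"

definition computable_set :: "nat set \<Rightarrow> bool" where
  "computable_set C \<longleftrightarrow> computable (\<lambda>x. if x \<in> C then 1 else 0)"

text \<open>
  Acceptability in the sense of Rogers: besides enumerating exactly the unary partial computable
  functions, the numbering satisfies the enumeration theorem (its universal function is partial
  computable) and the s-m-n theorem.
\<close>

definition acceptable_numbering :: "(nat \<Rightarrow> nat \<rightharpoonup> nat) \<Rightarrow> bool" where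
  "acceptable_numbering \<phi> \<longleftrightarrow>
     range \<phi> = {f. partial_computable f} \<and>
     partial_computable2 \<phi> \<and>
     (\<forall>\<psi>. partial_computable2 \<psi> \<longrightarrow> (\<exists>s. computable s \<and> (\<forall>e. \<phi> (s e) = \<psi> e)))"

definition M_set :: "(nat \<Rightarrow> nat \<rightharpoonup> nat) \<Rightarrow> nat set" where
  "M_set \<phi> = {p. \<phi> p 0 = Some 1}"

definition E0_set :: "(nat \<Rightarrow> nat \<rightharpoonup> nat) \<Rightarrow> nat set" where
  "E0_set \<phi> = {p. \<phi> p 0 = Some 0}"

end

(* Diagonalisation: the s-m-n theorem yields a computable s with phi (s e) 0 = phi e e.
   If C were a computable separator, e \<mapsto> 1 - [s e \<in> C] would be computable, say with index e;
   then phi (s e) 0 is 0 if s e \<in> C and 1 otherwise, which contradicts separation in both cases. *)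

theory Submission
  imports Defs
begin

text \<open>The ignored second argument gives the diagonal the binary form to which the s-m-n clause
  of \<open>acceptable_numbering\<close> applies.\<close>

lemma partial_computable2_diagonal:
  assumes "partial_computable2 \<phi>"
  shows "partial_computable2 (\<lambda>e _. \<phi> e e)"
proof -
  obtain u where u: "partial_recursive 2 u" "\<And>x y. \<phi> x y = u [x, y]"
    using assms unfolding partial_computable2_def by blast
  let ?p = "\<lambda>xs. Some (xs ! 0) :: nat option"
  have "partial_recursive 2 (pcomp u [?p, ?p])"
    by (rule partial_recursive.comp) (use u(1) in \<open>auto intro: partial_recursive.proj simp: numeral_2_eq_2\<close>)
  moreover have "\<phi> e e = pcomp u [?p, ?p] [e, x]" for e x
    by (simp add: pcomp_def u(2))
  ultimately show ?thesis
    unfolding partial_computable2_def by blast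
qed

lemma computable_compose:
  assumes "computable f" and "computable g"
  shows "computable (\<lambda>x. f (g x))"
proof -
  obtain F G where F: "partial_recursive 1 F" "\<And>x. Some (f x) = F [x]"
    and G: "partial_recursive 1 G" "\<And>x. Some (g x) = G [x]"
    using assms unfolding computable_def partial_computable_def by blast
  have "partial_recursive 1 (pcomp F [G])"
    by (rule partial_recursive.comp) (use F(1) G(1) in auto)
  moreover have "Some (f (g x)) = pcomp F [G] [x]" for x
    by (simp add: pcomp_def F(2) flip: G(2))
  ultimately show ?thesis
    unfolding computable_def partial_computable_def by blast
qed

text \<open>Truncated subtraction swaps 0 and 1, so composing with it negates a characteristic
  function. It is a primitive recursion with base value 1 and constant step 0.\<close>

lemma computable_one_minus: "computable (\<lambda>x. 1 - x)"
proof -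
  let ?z = "\<lambda>xs. Some 0 :: nat option"
  \<comment> \<open>The recursion has no parameters, so its base function has arity 0; the constant
    1 is built as the successor of zero.\<close>
  let ?one = "pcomp (\<lambda>xs. Some (Suc (xs ! 0))) [?z]"
  have "partial_recursive 0 ?one"
    by (rule partial_recursive.comp) (auto intro: partial_recursive.zero partial_recursive.succ[simplified])
  then have "partial_recursive (0 + 1) (primrecursion ?one ?z)"
    by (rule partial_recursive.prec) (rule partial_recursive.zero)
  moreover have "Some (1 - x) = primrecursion ?one ?z [x]" for x
  proof (induction x)
    case 0
    show ?case by (simp add: pcomp_def)
  next
    case (Suc x)
    \<comment> \<open>The step function ignores the previous value, but \<open>Option.bind\<close>
      requires that value to be defined; the induction hypothesis ensures this.\<close>
    show ?case by (simp flip: Suc.IH)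
  qed
  ultimately show ?thesis
    unfolding computable_def partial_computable_def by auto
qed

theorem corollary7p6:
  fixes \<phi> :: "nat \<Rightarrow> nat \<rightharpoonup> nat"
  assumes "acceptable_numbering \<phi>"
  shows "\<not> (\<exists>C. computable_set C \<and> M_set \<phi> \<subseteq> C \<and> C \<inter> E0_set \<phi> = {})"
proof
  assume "\<exists>C. computable_set C \<and> M_set \<phi> \<subseteq> C \<and> C \<inter> E0_set \<phi> = {}"
  then obtain C where C: "computable_set C" "M_set \<phi> \<subseteq> C" "C \<inter> E0_set \<phi> = {}"
    by blast
  have "partial_computable2 (\<lambda>e _. \<phi> e e)"
    using assms partial_computable2_diagonal unfolding acceptable_numbering_def by blast
  then obtain s where s: "computable s" "\<And>e. \<phi> (s e) = (\<lambda>_. \<phi> e e)"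
    using assms unfolding acceptable_numbering_def by blast
  let ?f = "\<lambda>x. 1 - (if s x \<in> C then 1 else 0 :: nat)"
  have "computable ?f"
    using computable_compose[OF computable_one_minus
        computable_compose[OF C(1)[unfolded computable_set_def] s(1)]] .
  then have "(\<lambda>x. Some (?f x)) \<in> range \<phi>"
    using assms unfolding acceptable_numbering_def computable_def by blast
  then obtain e where e: "\<phi> e = (\<lambda>x. Some (?f x))"
    by force
  have "\<phi> (s e) 0 = Some (?f e)"
    by (simp add: s(2) e)
  \<comment> \<open>If \<open>s e \<in> C\<close>, the value 0 puts \<open>s e\<close> into
    \<open>E0_set \<phi>\<close>, which is disjoint from \<open>C\<close>; otherwise the value 1
    puts it into \<open>M_set \<phi>\<close>, hence into \<open>C\<close>.\<close>
  then show False
    using C(2,3) by (cases "s e \<in> C") (auto simp: M_set_def E0_set_def)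
qed

end
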